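(* For every vertex $u\in\mathbb{N}=\{1,2,\dots\}$, almost surely, as $n\to\infty$, $$\frac{D_n(u)}{n}\to Z_u\quad\text{and}\quad \frac{L_n(u)}{n}\to Z_u .$$
   Context: The random friend tree process $(T_n)_{n\ge 2}$ is defined as follows. $T_2$ is a single edge joining vertices labelled $1$ and $2$. For $n\ge 2$, given $T_n$ (and the past of the process), $V_n$ is chosen uniformly at random in $\{1,\dots,n\}$, and then $W_n$ is a uniformly random neighbour of $V_n$ in $T_n$; $T_{n+1}$ is obtained from $T_n$ by adding a new vertex labelled $n+1$ joined by an edge to $W_n$. Thus $T_n$ is a tree with vertex set $[n]=\{1,\dots,n\}$. For $v\in[n]$, $D_n(v)$ is the degree of $v$ in $T_n$, and $L_n(v)$ is the number of neighbours of $v$ in $T_n$ that are leaves, i.e. have degree one in $T_n$. Finally $Z_v:=\liminf_{n\to\infty} D_n(v)/n$. *)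

theory Defs
  imports "HOL-Probability.Probability"
begin

text \<open>
  A graph on the positive integers is represented by its set of edges, an edge being the
  two-element set of its endpoints. This loses nothing here: a tree with at least two vertices has
  no isolated vertex, so the tree \<open>T n\<close> below, with vertex set \<open>{1..n}\<close>, is determined by its edges.
\<close>

type_synonym edge_set = "nat set set"

definition neighbours :: "edge_set \<Rightarrow> nat \<Rightarrow> nat set" where
  "neighbours E v = {w. {v, w} \<in> E}"

definition vertex_degree :: "edge_set \<Rightarrow> nat \<Rightarrow> nat" where
  "vertex_degree E v = card (neighbours E v)"

definition leaf_degree :: "edge_set \<Rightarrow> nat \<Rightarrow> nat" where
  "leaf_degree E v = card {w \<in> neighbours E v. vertex_degree E w = 1}"

text \<open>
  The process lives on an arbitrary probability space. The past at time \<open>n\<close> consists of the trees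
  \<open>T 2, \<dots>, T n\<close> and of the choices \<open>V k\<close>, \<open>W k\<close> with \<open>2 \<le> k < n\<close>. It takes countably many values up
  to a null event, so its conditional laws are given by elementary conditional probabilities on
  the events of positive probability. The values of \<open>T\<close>, \<open>V\<close> and \<open>W\<close> at times below 2 are
  irrelevant and left unconstrained.
\<close>

definition past ::
  "(nat \<Rightarrow> 'a \<Rightarrow> edge_set) \<Rightarrow> (nat \<Rightarrow> 'a \<Rightarrow> nat) \<Rightarrow> (nat \<Rightarrow> 'a \<Rightarrow> nat) \<Rightarrow>
   nat \<Rightarrow> (nat \<Rightarrow> edge_set) \<Rightarrow> (nat \<Rightarrow> nat) \<Rightarrow> (nat \<Rightarrow> nat) \<Rightarrow> 'a \<Rightarrow> bool" where
  "past T V W n t v w \<omega> \<longleftrightarrow>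
     (\<forall>k\<in>{2..n}. T k \<omega> = t k) \<and> (\<forall>k\<in>{2..<n}. V k \<omega> = v k \<and> W k \<omega> = w k)"

locale random_friend_tree = prob_space M for M :: "'a measure" +
  fixes T :: "nat \<Rightarrow> 'a \<Rightarrow> edge_set"
    and V W :: "nat \<Rightarrow> 'a \<Rightarrow> nat"
  assumes V_measurable: "n \<ge> 2 \<Longrightarrow> V n \<in> measurable M (count_space UNIV)"
    and W_measurable: "n \<ge> 2 \<Longrightarrow> W n \<in> measurable M (count_space UNIV)"
    and T_2: "\<omega> \<in> space M \<Longrightarrow> T 2 \<omega> = {{1, 2}}"
    and T_Suc: "\<omega> \<in> space M \<Longrightarrow> n \<ge> 2 \<Longrightarrow> T (Suc n) \<omega> = insert {W n \<omega>, Suc n} (T n \<omega>)"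
    and V_uniform:
      "\<lbrakk>n \<ge> 2; \<P>(\<omega> in M. past T V W n t v w \<omega>) > 0; x \<in> {1..n}\<rbrakk> \<Longrightarrow>
        \<P>(\<omega> in M. V n \<omega> = x \<bar> past T V W n t v w \<omega>) = 1 / real n"
    and W_uniform:
      "\<lbrakk>n \<ge> 2; \<P>(\<omega> in M. past T V W n t v w \<omega> \<and> V n \<omega> = x) > 0; y \<in> neighbours (t n) x\<rbrakk> \<Longrightarrow>
        \<P>(\<omega> in M. W n \<omega> = y \<bar> past T V W n t v w \<omega> \<and> V n \<omega> = x) = 1 / real (vertex_degree (t n) x)"

definition Z :: "(nat \<Rightarrow> 'a \<Rightarrow> edge_set) \<Rightarrow> nat \<Rightarrow> 'a \<Rightarrow> real" where
  "Z T v \<omega> = real_of_ereal (liminf (\<lambda>n. ereal (real (vertex_degree (T n \<omega>) v) / real n)))"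

lemma (in random_friend_tree) degree_le:
  assumes "\<omega> \<in> space M" "n \<ge> 2"
  shows "finite (neighbours (T n \<omega>) v) \<and> vertex_degree (T n \<omega>) v \<le> n"
  using assms(2)
proof (induction n rule: dec_induct)
  case base
  have "neighbours (T 2 \<omega>) v \<subseteq> {if v = 1 then 2 else 1}"
    unfolding T_2[OF assms(1)] neighbours_def by (auto simp: doubleton_eq_iff)
  from finite_subset[OF this] card_mono[OF _ this] show ?case
    by (simp add: vertex_degree_def)
next
  case (step n)
  let ?y = "if v = Suc n then W n \<omega> else Suc n"
  have "neighbours (T (Suc n) \<omega>) v \<subseteq> insert ?y (neighbours (T n \<omega>) v)"
    unfolding T_Suc[OF assms(1) step(1)] neighbours_def by (auto simp: doubleton_eq_iff)
  moreover have "finite (insert ?y (neighbours (T n \<omega>) v))" using step by simp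
  moreover have "card (insert ?y (neighbours (T n \<omega>) v)) \<le> Suc n"
    using step by (simp add: vertex_degree_def card_insert_if)
  ultimately show ?case
    unfolding vertex_degree_def by (meson card_mono finite_subset le_trans)
qed

text \<open>The lower limit is finite, so \<open>Z\<close> is not affected by \<open>real_of_ereal\<close> sending infinities to 0.\<close>

lemma (in random_friend_tree) ereal_Z:
  assumes "\<omega> \<in> space M"
  shows "ereal (Z T v \<omega>) = liminf (\<lambda>n. ereal (real (vertex_degree (T n \<omega>) v) / real n))"
proof -
  let ?f = "\<lambda>n. ereal (real (vertex_degree (T n \<omega>) v) / real n)"
  have "0 \<le> liminf ?f" by (intro Liminf_bounded) auto
  moreover have "limsup ?f \<le> 1"
    by (intro Limsup_bounded eventually_sequentiallyI[of 2])
      (use degree_le[OF assms] in \<open>simp add: divide_le_eq\<close>)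
  then have "liminf ?f \<le> 1"
    using Liminf_le_Limsup[of sequentially ?f] by (meson order_trans sequentially_bot)
  ultimately have "\<bar>liminf ?f\<bar> \<noteq> \<infinity>" by auto
  then show ?thesis unfolding Z_def by (simp add: ereal_real)
qed

end

theory Submission
  imports Defs
begin

text \<open>
  Fix a vertex \<open>u\<close> and write \<open>D n\<close> for its degree at time \<open>n\<close>. Given the past, \<open>u\<close> is chosen as \<open>W n\<close>,
  and so gains a neighbour, with probability \<open>p n = (\<Sum>x. 1 / degree x) / n\<close>, the sum running over
  the neighbours \<open>x\<close> of \<open>u\<close>. Every term is at most 1, whence \<open>p n \<le> D n / n\<close>, and
  this makes \<open>D n / n\<close> a supermartingale from time \<open>u\<close> on: its increment is
  \<open>(indicator (W n = u) - D n / n) / (n + 1)\<close>, which is at most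
  \<open>(indicator (W n = u) - p n) / (n + 1)\<close>.

  The differences \<open>indicator (W n = u) - p n\<close> are bounded by 1 and orthogonal in \<open>L\<^sup>2\<close>, because each
  has conditional mean zero given the past. Their series with weights \<open>1 / (n + 1)\<close> therefore
  converges almost surely (\<open>AE_convergent_orthogonal_series\<close>). A nonnegative sequence whose increments are
  dominated by the terms of a convergent series converges, so \<open>D n / n\<close> converges, and its limit
  is then the lower limit \<open>Z\<close>.

  For the leaves, count the neighbours of \<open>u\<close> that are not leaves. This number grows only when a
  leaf adjacent to \<open>u\<close> receives the new vertex. The only neighbour of such a leaf is \<open>u\<close>, so this
  forces \<open>V n = u\<close> (\<open>nonleaf_degree_Suc\<close>), an event of probability \<open>1 / n\<close>. As the sum of
  \<open>1 / n\<^sup>2\<close> converges, the sum of \<open>indicator (V n = u) / n\<close> is finite almost surely, and by the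
  argument of Kronecker's lemma \<open>u\<close> has \<open>o(n)\<close> neighbours that are not leaves. So
  \<open>D n / n\<close> and the leaf degree over \<open>n\<close> have the same limit.

  Conditional expectations are handled through histories, the lists of choices made so far. They
  range over a countable type, so an expectation vanishes as soon as its restriction to every
  history does (\<open>expectation_eq_0_if_fibrewise\<close>).
\<close>

section \<open>Convergence of real sequences\<close>

text \<open>
  Along the cubes, \<open>g\<close> bounds the oscillation of \<open>f\<close> within each block. The blocks between cubes are
  long enough to sum variances and short enough for a series with terms of size \<open>1 / n\<close> to
  oscillate little inside them.
\<close>

lemma LIMSEQ_from_cubes:
  fixes f :: "nat \<Rightarrow> real"
  assumes cubes: "(\<lambda>k. f (k ^ 3)) \<longlonglongrightarrow> l" and g: "g \<longlonglongrightarrow> 0"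
    and near: "\<And>k n. k ^ 3 \<le> n \<Longrightarrow> n < Suc k ^ 3 \<Longrightarrow> \<bar>f n - f (k ^ 3)\<bar> \<le> g k"
  shows "f \<longlonglongrightarrow> l"
proof -
  \<comment> \<open>the integer cube root of \<open>n\<close>\<close>
  define r where "r n = (GREATEST k. k ^ 3 \<le> (n::nat))" for n
  have bnd: "\<And>k n::nat. k ^ 3 \<le> n \<Longrightarrow> k \<le> n"
    by (metis le_trans power_increasing self_le_power zero_less_numeral gr0I le0 less_one linorder_not_less one_le_numeral)
  have r_le: "r n ^ 3 \<le> n" for n
    unfolding r_def by (rule GreatestI_nat[where k = 0 and b = n]) (auto intro: bnd)
  have r_ge: "k \<le> r n" if "k ^ 3 \<le> n" for k n
    unfolding r_def using that by (rule Greatest_le_nat[where b = n]) (auto intro: bnd)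
  have r_less: "n < Suc (r n) ^ 3" for n
    using r_ge[of "Suc (r n)" n] by (meson Suc_n_not_le_n not_less)
  have r_lim: "filterlim r at_top sequentially"
    unfolding filterlim_at_top
    by (intro allI eventually_sequentiallyI[where c = "_ ^ 3"] r_ge)
  have "(\<lambda>n. f n - f (r n ^ 3)) \<longlonglongrightarrow> 0"
    by (rule Lim_null_comparison[OF _ filterlim_compose[OF g r_lim]])
      (use near[OF r_le r_less] in auto)
  from tendsto_add[OF this filterlim_compose[OF cubes r_lim]] show ?thesis by simp
qed

text \<open>
  The pathwise core of supermartingale convergence, with the martingale part replaced by the partial
  sums of \<open>a\<close>.
\<close>

lemma convergent_if_increments_le_series:
  fixes X a :: "nat \<Rightarrow> real"
  assumes X: "\<And>n. X n \<ge> 0" and a: "convergent (\<lambda>n. \<Sum>j<n. a j)"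
    and step: "\<And>n. n \<ge> m \<Longrightarrow> X (Suc n) \<le> X n + a n"
  shows "convergent X"
proof -
  let ?S = "\<lambda>n. \<Sum>j<n. a j"
  let ?Y = "\<lambda>n. X (n + m) - ?S (n + m)"
  \<comment> \<open>Subtracting the series leaves a decreasing sequence that is bounded below.\<close>
  have "decseq ?Y" using step by (intro decseq_SucI) (simp add: algebra_simps)
  moreover obtain B where "\<And>n. ?S n \<le> B"
    using Bseq_bdd_above[OF convergent_imp_Bseq[OF a]] by (auto simp: bdd_above_def)
  then have "- B \<le> ?Y n" for n using X[of "n + m"] by (smt (verit))
  ultimately have "convergent ?Y" by (blast intro: decseq_convergent convergentI)
  then have "convergent (\<lambda>n. X n - ?S n)"
    using convergent_ignore_initial_segment[of "\<lambda>n. X n - ?S n" m] by simp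
  from convergent_add[OF this a] show ?thesis by simp
qed

text \<open>
  A one-sided form of Kronecker's lemma.
\<close>

lemma sublinear_if_increments_summable:
  fixes N b :: "nat \<Rightarrow> real"
  assumes N: "\<And>n. N n \<ge> 0" and b: "\<And>n. b n \<ge> 0" and sum: "summable (\<lambda>n. b n / real n)"
    and step: "\<And>n. n \<ge> m \<Longrightarrow> N (Suc n) \<le> N n + b n"
  shows "(\<lambda>n. N n / real n) \<longlonglongrightarrow> 0"
proof (rule LIMSEQ_I)
  fix \<epsilon> :: real assume \<epsilon>: "\<epsilon> > 0"
  from summable_partial_sum_bound[OF sum, of "\<epsilon> / 2"] \<epsilon>
  obtain K where K: "\<And>i n. i \<ge> K \<Longrightarrow> norm (\<Sum>k=i..n. b k / real k) < \<epsilon> / 2" by auto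
  define i where "i = max (Suc m) K"
  have tail: "(\<Sum>k=i..<n. b k / real k) < \<epsilon> / 2" for n
    using K[of i "n - 1"] \<epsilon> by (cases n) (auto simp: i_def atLeastLessThanSuc_atLeastAtMost)
  have grow: "N n \<le> N i + (\<Sum>k=i..<n. b k)" if "n \<ge> i" for n
    using that
  proof (induction n rule: dec_induct)
    case (step n)
    from step.hyps(1) have "m \<le> n" by (simp add: i_def)
    with assms(4)[of n] step show ?case by (simp add: sum.atLeastLessThan_Suc)
  qed simp
  have bound: "N n / real n < N i / real n + \<epsilon> / 2" if n: "n \<ge> i" for n
  proof -
    have n0: "n > 0" using n by (simp add: i_def)
    \<comment> \<open>The increments from time \<open>i\<close> on contribute at most \<open>n\<close> times a tail of the convergent series.\<close>
    have "(\<Sum>k=i..<n. b k) \<le> (\<Sum>k=i..<n. real n * (b k / real k))"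
    proof (rule sum_mono)
      fix k assume "k \<in> {i..<n}"
      then have k: "0 < k" "k \<le> n" by (auto simp: i_def)
      then have "b k * real k \<le> b k * real n" using b by (intro mult_left_mono) auto
      then show "b k \<le> real n * (b k / real k)" using k by (simp add: field_simps)
    qed
    also have "\<dots> < real n * (\<epsilon> / 2)"
      unfolding sum_distrib_left[symmetric] using n0 tail by (intro mult_strict_left_mono) auto
    finally show ?thesis using grow[OF n] n0 by (simp add: field_simps)
  qed
  have "(\<lambda>n. N i / real n) \<longlonglongrightarrow> 0" by (rule lim_const_over_n)
  then obtain K' where K': "\<And>n. n \<ge> K' \<Longrightarrow> \<bar>N i / real n\<bar> < \<epsilon> / 2"
    using LIMSEQ_D[of "\<lambda>n. N i / real n" 0 "\<epsilon> / 2"] \<epsilon> by auto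
  show "\<exists>no. \<forall>n\<ge>no. norm (N n / real n - 0) < \<epsilon>"
  proof (intro exI allI impI)
    fix n assume "n \<ge> max i K'"
    then have "N n / real n < \<epsilon>" using bound[of n] K'[of n] by linarith
    then show "norm (N n / real n - 0) < \<epsilon>" using N[of n] by simp
  qed
qed

section \<open>Almost sure convergence of random series\<close>

text \<open>
  By monotone convergence the sum has a finite expectation, hence is almost surely finite.
\<close>

lemma AE_summable_if_summable_expectation:
  fixes f :: "nat \<Rightarrow> 'a \<Rightarrow> real"
  assumes int: "\<And>k. integrable M (f k)" and nonneg: "\<And>k x. f k x \<ge> 0"
    and bound: "\<And>k. (\<integral>x. f k x \<partial>M) \<le> b k" and "summable b"
  shows "AE x in M. summable (\<lambda>k. f k x)"
proof -
  have "summable (\<lambda>k. \<integral>x. f k x \<partial>M)"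
    by (rule summable_comparison_test'[OF \<open>summable b\<close>, of 0])
      (use nonneg bound in \<open>auto simp: integral_nonneg_AE\<close>)
  then have fin: "(\<Sum>k. ennreal (\<integral>x. f k x \<partial>M)) < \<infinity>"
    using nonneg by (subst suminf_ennreal2) (auto simp: integral_nonneg_AE)
  have "(\<integral>\<^sup>+x. (\<Sum>k. ennreal (f k x)) \<partial>M) = (\<Sum>k. \<integral>\<^sup>+x. ennreal (f k x) \<partial>M)"
    using int by (intro nn_integral_suminf) auto
  also have "\<dots> = (\<Sum>k. ennreal (\<integral>x. f k x \<partial>M))"
    using int nonneg by (intro suminf_cong nn_integral_eq_integral) auto
  finally have "(\<integral>\<^sup>+x. (\<Sum>k. ennreal (f k x)) \<partial>M) \<noteq> \<infinity>" using fin by auto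
  then have "AE x in M. (\<Sum>k. ennreal (f k x)) \<noteq> \<infinity>"
    by (intro nn_integral_PInf_AE) (use int in auto)
  then show ?thesis
    by eventually_elim (use nonneg in \<open>auto intro: summable_suminf_not_top\<close>)
qed

context prob_space begin

text \<open>
  By orthogonality the partial sum over the block of indices from \<open>k\<^sup>3\<close> to \<open>(k+1)\<^sup>3\<close> has second
  moment \<open>O(1 / k\<^sup>4)\<close>, so the block sums are absolutely summable almost surely, and the partial
  sums converge along the cubes. Within a block the partial sums move by only \<open>O(1 / k)\<close>. This
  replaces a maximal inequality.
\<close>

lemma AE_convergent_orthogonal_series:
  fixes \<xi> :: "nat \<Rightarrow> 'a \<Rightarrow> real"
  assumes [measurable]: "\<And>j. \<xi> j \<in> borel_measurable M"
    and bound: "\<And>j \<omega>. \<omega> \<in> space M \<Longrightarrow> \<bar>\<xi> j \<omega>\<bar> \<le> 1"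
    and orth: "\<And>i j. i < j \<Longrightarrow> expectation (\<lambda>\<omega>. \<xi> i \<omega> * \<xi> j \<omega>) = 0"
  shows "AE \<omega> in M. convergent (\<lambda>n. \<Sum>j<n. \<xi> j \<omega> / real (Suc j))"
proof -
  let ?B = "\<lambda>k::nat. {k ^ 3..<Suc k ^ 3}"
  define S where "S n \<omega> = (\<Sum>j<n. \<xi> j \<omega> / real (Suc j))" for n \<omega>
  define Y where "Y k \<omega> = (\<Sum>j\<in>?B k. \<xi> j \<omega> / real (Suc j))" for k \<omega>
  have [measurable]: "Y k \<in> borel_measurable M" for k unfolding Y_def by measurable
  have S_diff: "S n \<omega> - S m \<omega> = (\<Sum>j\<in>{m..<n}. \<xi> j \<omega> / real (Suc j))" if "m \<le> n" for m n \<omega>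
    unfolding S_def using sum_diff_nat_ivl[of 0 m n "\<lambda>j. \<xi> j \<omega> / real (Suc j)"] that
    by (simp add: atLeast0LessThan)
  have pow3: "k ^ 3 \<le> Suc k ^ 3" for k :: nat by (simp add: power_mono)
  have len: "real (Suc k ^ 3 - k ^ 3) \<le> 3 * real (Suc k) ^ 2" for k
    using pow3[of k] by (simp add: of_nat_diff power3_eq_cube power2_eq_square algebra_simps)
  \<comment> \<open>The \<open>k\<close>th block has about \<open>3 k\<^sup>2\<close> terms, each of size at most \<open>4 / (k+1)\<^sup>3\<close>.\<close>
  have low: "real (Suc k) ^ 3 / 4 \<le> real (Suc j)" if "k ^ 3 \<le> j" for j k
  proof -
    have "0 \<le> (real k + 1) * (real k - 1)^2" by simp
    then have "real (Suc k) ^ 3 / 4 \<le> real k ^ 3 + 1"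
      by (simp add: power3_eq_cube power2_eq_square algebra_simps)
    also have "real k ^ 3 \<le> real j" using that by (metis of_nat_le_iff of_nat_power)
    finally show ?thesis by simp
  qed
  have int2: "integrable M (\<lambda>\<omega>. \<xi> i \<omega> * \<xi> j \<omega>)" for i j
    by (rule integrable_const_bound[where B = 1])
      (use bound in \<open>auto simp: abs_mult mult_le_one\<close>)
  have orth': "expectation (\<lambda>\<omega>. \<xi> i \<omega> * \<xi> j \<omega>) = 0" if "i \<noteq> j" for i j
    using orth[of i j] orth[of j i] that by (auto simp: neq_iff mult.commute)
  have sq: "expectation (\<lambda>\<omega>. \<xi> i \<omega> * \<xi> i \<omega>) \<le> 1" for i
    using integral_mono[OF int2[of i i] integrable_const[of 1]] bound[of _ i]
    by (simp add: prob_space abs_square_le_1 flip: power2_eq_square)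
  have Ysq: "(Y k \<omega>)\<^sup>2 =
      (\<Sum>i\<in>?B k. \<Sum>j\<in>?B k. \<xi> i \<omega> * \<xi> j \<omega> / (real (Suc i) * real (Suc j)))" for k \<omega>
    unfolding Y_def power2_eq_square sum_product by (simp add: mult.commute)
  have intY2: "integrable M (\<lambda>\<omega>. (Y k \<omega>)\<^sup>2)" for k
    unfolding Ysq by (intro Bochner_Integration.integrable_sum integrable_divide_zero int2)
  have EY2: "expectation (\<lambda>\<omega>. (Y k \<omega>)\<^sup>2) \<le> 48 / real (Suc k) ^ 4" for k
  proof -
    have "expectation (\<lambda>\<omega>. (Y k \<omega>)\<^sup>2) =
        (\<Sum>i\<in>?B k. \<Sum>j\<in>?B k. expectation (\<lambda>\<omega>. \<xi> i \<omega> * \<xi> j \<omega>) / (real (Suc i) * real (Suc j)))"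
      unfolding Ysq using int2 by (simp add: Bochner_Integration.integral_sum)
    also have "\<dots> = (\<Sum>i\<in>?B k. \<Sum>j\<in>?B k. if i = j then
        expectation (\<lambda>\<omega>. \<xi> i \<omega> * \<xi> i \<omega>) / (real (Suc i) * real (Suc i)) else 0)"
      by (intro sum.cong refl) (auto simp: orth')
    also have "\<dots> = (\<Sum>i\<in>?B k. expectation (\<lambda>\<omega>. \<xi> i \<omega> * \<xi> i \<omega>) / (real (Suc i) * real (Suc i)))"
      by (simp add: sum.delta')
    also have "\<dots> \<le> (\<Sum>i\<in>?B k. 1 / ((real (Suc k) ^ 3 / 4) * (real (Suc k) ^ 3 / 4)))"
      by (intro sum_mono frac_le mult_mono low sq) (auto simp: zero_less_mult_iff)
    also have "\<dots> = real (Suc k ^ 3 - k ^ 3) * (16 / real (Suc k) ^ 6)"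
      by (simp add: power_add[symmetric] field_simps del: of_nat_Suc power_Suc of_nat_diff)
    also have "\<dots> \<le> 3 * real (Suc k) ^ 2 * (16 / real (Suc k) ^ 6)"
      by (intro mult_right_mono len) auto
    also have "\<dots> = 48 / real (Suc k) ^ 4"
      by (simp add: divide_simps flip: power_add del: of_nat_Suc power_Suc)
    finally show ?thesis .
  qed
  have summ: "summable (\<lambda>k. 1 / real (Suc k) ^ 2)"
    using inverse_power_summable[of 2, where 'a = real]
    by (subst summable_Suc_iff) (simp add: inverse_eq_divide)
  have "AE \<omega> in M. summable (\<lambda>k. real (Suc k) ^ 2 * (Y k \<omega>)\<^sup>2)"
  proof (rule AE_summable_if_summable_expectation[where b = "\<lambda>k. 48 * (1 / real (Suc k) ^ 2)"])
    fix k
    have "expectation (\<lambda>\<omega>. real (Suc k) ^ 2 * (Y k \<omega>)\<^sup>2) =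
        real (Suc k) ^ 2 * expectation (\<lambda>\<omega>. (Y k \<omega>)\<^sup>2)" by simp
    also have "\<dots> \<le> real (Suc k) ^ 2 * (48 / real (Suc k) ^ 4)"
      by (intro mult_left_mono EY2) auto
    also have "\<dots> = 48 * (1 / real (Suc k) ^ 2)"
      by (simp add: divide_simps flip: power_add del: of_nat_Suc power_Suc)
    finally show "expectation (\<lambda>\<omega>. real (Suc k) ^ 2 * (Y k \<omega>)\<^sup>2) \<le> 48 * (1 / real (Suc k) ^ 2)" .
  next
    show "summable (\<lambda>k. 48 * (1 / real (Suc k) ^ 2))" by (rule summable_mult[OF summ])
  qed (use intY2 in auto)
  then show ?thesis using AE_space
  proof eventually_elim
    fix \<omega> assume *: "summable (\<lambda>k. real (Suc k) ^ 2 * (Y k \<omega>)\<^sup>2)" and \<omega>: "\<omega> \<in> space M"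
    \<comment> \<open>Square summability with weights \<open>(k+1)\<^sup>2\<close> gives absolute summability, by the inequality of
      arithmetic and geometric means.\<close>
    have amgm: "\<bar>Y k \<omega>\<bar> \<le> 1 / real (Suc k) ^ 2 + real (Suc k) ^ 2 * (Y k \<omega>)\<^sup>2" for k
    proof -
      define c where "c = real (Suc k)"
      have c: "c > 0" by (simp add: c_def)
      have "0 \<le> (1 / c - c * \<bar>Y k \<omega>\<bar>)\<^sup>2" by simp
      also have "\<dots> = 1 / c ^ 2 + c ^ 2 * (Y k \<omega>)\<^sup>2 - 2 * \<bar>Y k \<omega>\<bar>"
        using c by (simp add: power2_diff power_mult_distrib power_divide)
      finally show ?thesis unfolding c_def by linarith
    qed
    have "summable (\<lambda>k. Y k \<omega>)"
      by (rule summable_comparison_test'[OF summable_add[OF summ *], of 0]) (use amgm in simp)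
    then have "convergent (\<lambda>m. \<Sum>k<m. Y k \<omega>)" by (simp add: summable_iff_convergent)
    moreover have "(\<Sum>k<m. Y k \<omega>) = S (m ^ 3) \<omega>" for m
    proof -
      have "Y k \<omega> = S (Suc k ^ 3) \<omega> - S (k ^ 3) \<omega>" for k
        unfolding Y_def by (rule S_diff[symmetric, OF pow3])
      then show ?thesis
        using sum_lessThan_telescope[of "\<lambda>k. S (k ^ 3) \<omega>" m] by (simp add: S_def)
    qed
    ultimately obtain l where l: "(\<lambda>m. S (m ^ 3) \<omega>) \<longlonglongrightarrow> l" by (auto simp: convergent_def)
    have "(\<lambda>n. S n \<omega>) \<longlonglongrightarrow> l"
    proof (rule LIMSEQ_from_cubes[OF l])
      show "(\<lambda>k. 12 * (1 / real (Suc k))) \<longlonglongrightarrow> 0"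
        by (intro tendsto_mult_right_zero LIMSEQ_Suc lim_1_over_n)
      fix k n :: nat assume n: "k ^ 3 \<le> n" "n < Suc k ^ 3"
      have "\<bar>S n \<omega> - S (k ^ 3) \<omega>\<bar> \<le> (\<Sum>j\<in>{k^3..<n}. \<bar>\<xi> j \<omega> / real (Suc j)\<bar>)"
        unfolding S_diff[OF n(1)] by (rule sum_abs)
      also have "\<dots> \<le> (\<Sum>j\<in>{k^3..<n}. 1 / (real (Suc k) ^ 3 / 4))"
        unfolding abs_divide by (intro sum_mono frac_le) (use bound[OF \<omega>] low in auto)
      also have "\<dots> = real (n - k ^ 3) * (4 / real (Suc k) ^ 3)" by simp
      also have "\<dots> \<le> 3 * real (Suc k) ^ 2 * (4 / real (Suc k) ^ 3)"
      proof (intro mult_right_mono)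
        have "real (n - k ^ 3) \<le> real (Suc k ^ 3 - k ^ 3)" using n by (intro of_nat_mono) simp
        with len[of k] show "real (n - k ^ 3) \<le> 3 * real (Suc k) ^ 2" by linarith
      qed auto
      also have "\<dots> = 12 * (1 / real (Suc k))"
        by (simp add: divide_simps power2_eq_square power3_eq_cube del: of_nat_Suc)
      finally show "\<bar>S n \<omega> - S (k ^ 3) \<omega>\<bar> \<le> 12 * (1 / real (Suc k))" .
    qed
    then show "convergent (\<lambda>n. \<Sum>j<n. \<xi> j \<omega> / real (Suc j))"
      unfolding S_def convergent_def by blast
  qed
qed

text \<open>
  The fibres of \<open>X\<close> form a countable partition, over which the integral is additive. This stands in
  for conditioning on \<open>X\<close>.
\<close>

lemma expectation_eq_0_if_fibrewise:
  fixes X :: "'a \<Rightarrow> 'b::countable" and f :: "'a \<Rightarrow> real"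
  assumes X[measurable]: "X \<in> measurable M (count_space UNIV)" and f: "integrable M f"
    and fib: "\<And>x. expectation (\<lambda>\<omega>. of_bool (X \<omega> = x) * f \<omega>) = 0"
  shows "expectation f = 0"
proof -
  let ?A = "\<lambda>i. {\<omega> \<in> space M. to_nat (X \<omega>) = i}"
  have meas: "?A i \<in> sets M" for i by measurable
  have U: "(\<Union>i. ?A i) = space M" by auto
  have 0: "set_lebesgue_integral M (?A i) f = 0" for i
  proof (cases "\<exists>x::'b. to_nat x = i")
    case True
    then obtain x :: 'b where x: "to_nat x = i" by blast
    have "set_lebesgue_integral M (?A i) f = expectation (\<lambda>\<omega>. of_bool (X \<omega> = x) * f \<omega>)"
      unfolding set_lebesgue_integral_def
      by (intro Bochner_Integration.integral_cong) (auto simp: indicator_def x[symmetric])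
    then show ?thesis using fib by simp
  next
    case False
    then have "?A i = {}" by auto
    then show ?thesis by (simp add: set_lebesgue_integral_def)
  qed
  have "expectation f = set_lebesgue_integral M (\<Union>i. ?A i) f"
    unfolding U by (simp add: set_integral_space[OF f])
  also have "\<dots> = (\<Sum>i. set_lebesgue_integral M (?A i) f)"
  proof (rule lebesgue_integral_countable_add)
    show "set_integrable M (\<Union>i. ?A i) f"
      unfolding U set_integrable_def by (rule integrable_mult_indicator[OF sets.top f])
  qed (auto intro: meas)
  also have "\<dots> = 0" unfolding 0 by simp
  finally show ?thesis .
qed

lemma prob_eq_sum_values:
  fixes X :: "'a \<Rightarrow> nat"
  assumes "finite S" and [measurable]: "X \<in> measurable M (count_space UNIV)" "Measurable.pred M Q"
  shows "\<P>(\<omega> in M. Q \<omega> \<and> X \<omega> \<in> S) = (\<Sum>x\<in>S. \<P>(\<omega> in M. Q \<omega> \<and> X \<omega> = x))"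
proof -
  have "{\<omega> \<in> space M. Q \<omega> \<and> X \<omega> \<in> S} = (\<Union>x\<in>S. {\<omega> \<in> space M. Q \<omega> \<and> X \<omega> = x})" by auto
  also have "measure M \<dots> = (\<Sum>x\<in>S. \<P>(\<omega> in M. Q \<omega> \<and> X \<omega> = x))"
    using assms(1) by (intro finite_measure_finite_Union) (auto simp: disjoint_family_on_def)
  finally show ?thesis .
qed

lemma AE_in_if_prob_sum_eq:
  fixes X :: "'a \<Rightarrow> nat"
  assumes S: "finite S" and X: "X \<in> measurable M (count_space UNIV)"
    and Q[measurable]: "Measurable.pred M Q"
    and sum: "(\<Sum>x\<in>S. \<P>(\<omega> in M. Q \<omega> \<and> X \<omega> = x)) = \<P>(\<omega> in M. Q \<omega>)"
  shows "AE \<omega> in M. Q \<omega> \<longrightarrow> X \<omega> \<in> S"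
proof -
  have [measurable]: "Measurable.pred M (\<lambda>\<omega>. X \<omega> \<in> S)"
    by (rule pred_sets2[OF _ X]) simp
  have "\<P>(\<omega> in M. Q \<omega> \<and> X \<omega> \<notin> S) =
      measure M ({\<omega> \<in> space M. Q \<omega>} - {\<omega> \<in> space M. Q \<omega> \<and> X \<omega> \<in> S})"
    by (rule arg_cong[where f = "measure M"]) auto
  also have "\<dots> = \<P>(\<omega> in M. Q \<omega>) - \<P>(\<omega> in M. Q \<omega> \<and> X \<omega> \<in> S)"
    by (rule finite_measure_Diff) auto
  also have "\<dots> = 0" using sum by (simp add: prob_eq_sum_values[OF S X Q])
  finally have "emeasure M {\<omega> \<in> space M. \<not> (Q \<omega> \<longrightarrow> X \<omega> \<in> S)} = 0"
    by (simp add: emeasure_eq_measure)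
  then show ?thesis by (subst AE_iff_measurable[OF _ refl]) auto
qed

lemma expectation_of_bool:
  "Measurable.pred M Q \<Longrightarrow> expectation (\<lambda>\<omega>. of_bool (Q \<omega>)) = \<P>(\<omega> in M. Q \<omega>)"
  by (subst Bochner_Integration.integral_cong[where g = "indicat_real {\<omega> \<in> space M. Q \<omega>}", OF refl])
    (auto simp: indicator_def)

lemma integrable_of_bool:
  "Measurable.pred M Q \<Longrightarrow> integrable M (\<lambda>\<omega>. of_bool (Q \<omega>) :: real)"
  by (rule integrable_const_bound[where B = 1]) auto

end

section \<open>Neighbours and non-leaf neighbours\<close>

lemma neighbours_insert:
  "neighbours (insert {a, b} E) v =
     neighbours E v \<union> (if v = a then {b} else {}) \<union> (if v = b then {a} else {})"
  by (auto simp: neighbours_def doubleton_eq_iff)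

lemma neighbours_sym: "w \<in> neighbours E v \<longleftrightarrow> v \<in> neighbours E w"
  by (simp add: neighbours_def insert_commute)

definition nonleaf_degree :: "edge_set \<Rightarrow> nat \<Rightarrow> nat" where
  "nonleaf_degree E v = card {w \<in> neighbours E v. vertex_degree E w \<noteq> 1}"

lemma vertex_degree_eq_leaf_plus_nonleaf:
  assumes "finite (neighbours E v)"
  shows "vertex_degree E v = leaf_degree E v + nonleaf_degree E v"
proof -
  let ?L = "{w \<in> neighbours E v. vertex_degree E w = 1}"
  let ?N = "{w \<in> neighbours E v. vertex_degree E w \<noteq> 1}"
  have "card (?L \<union> ?N) = card ?L + card ?N" using assms by (intro card_Un_disjoint) auto
  moreover have "?L \<union> ?N = neighbours E v" by auto
  ultimately show ?thesis by (simp add: vertex_degree_def leaf_degree_def nonleaf_degree_def)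
qed

section \<open>Histories\<close>

context random_friend_tree begin

text \<open>
  Since \<open>T n\<close> is determined by these choices, the history carries the same information as the past.
  Unlike the past it takes values in a countable type.
\<close>

definition history :: "nat \<Rightarrow> 'a \<Rightarrow> (nat \<times> nat) list" where
  "history n \<omega> = map (\<lambda>k. (V k \<omega>, W k \<omega>)) [2..<n]"

lemma history_eq_iff:
  "history n \<omega> = history n \<omega>' \<longleftrightarrow> (\<forall>k\<in>{2..<n}. V k \<omega> = V k \<omega>' \<and> W k \<omega> = W k \<omega>')"
  by (auto simp: history_def map_eq_conv)

lemma T_eq_if_history_eq:
  assumes "\<omega> \<in> space M" "\<omega>' \<in> space M" "history n \<omega> = history n \<omega>'" "k \<in> {2..n}"
  shows "T k \<omega> = T k \<omega>'"
proof -
  have "2 \<le> k" "k \<le> n" using assms(4) by auto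
  then show ?thesis
  proof (induction k rule: dec_induct)
    case base
    show ?case using assms(1,2) by (simp add: T_2)
  next
    case (step k)
    then show ?case using assms(1-3) by (simp add: T_Suc history_eq_iff)
  qed
qed

lemma past_iff_history_eq:
  assumes "\<omega> \<in> space M" "\<omega>' \<in> space M"
  shows "past T V W n (\<lambda>k. T k \<omega>') (\<lambda>k. V k \<omega>') (\<lambda>k. W k \<omega>') \<omega> \<longleftrightarrow> history n \<omega> = history n \<omega>'"
  using T_eq_if_history_eq[OF assms, of n] unfolding past_def history_eq_iff by blast

lemma measurable_history [measurable]: "history n \<in> measurable M (count_space UNIV)"
proof (subst measurable_count_space_eq2_countable, intro conjI ballI)
  fix h :: "(nat \<times> nat) list"
  have [measurable]: "V k \<in> measurable M (count_space UNIV)" "W k \<in> measurable M (count_space UNIV)"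
    if "k \<in> {2..<n}" for k using that by (auto intro: V_measurable W_measurable)
  have "history n -` {h} \<inter> space M = {\<omega> \<in> space M. length h = n - 2 \<and>
      (\<forall>k\<in>{2..<n}. V k \<omega> = fst (h ! (k - 2)) \<and> W k \<omega> = snd (h ! (k - 2)))}"
    (is "?L = ?R")
  proof (intro set_eqI iffI)
    fix \<omega> assume "\<omega> \<in> ?L"
    then have h: "h = history n \<omega>" and "\<omega> \<in> space M" by auto
    moreover have "h ! (k - 2) = (V k \<omega>, W k \<omega>)" if "k \<in> {2..<n}" for k
    proof -
      from that have "[2..<n] ! (k - 2) = k" "k - 2 < length [2..<n]" by (auto simp del: upt_Suc)
      then show ?thesis unfolding h history_def by (simp only: nth_map)
    qed
    ultimately show "\<omega> \<in> ?R" by (simp add: history_def)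
  next
    fix \<omega> assume \<omega>: "\<omega> \<in> ?R"
    have "history n \<omega> = h"
    proof (rule nth_equalityI)
      fix i assume "i < length (history n \<omega>)"
      then have i: "i < n - 2" by (simp add: history_def)
      then have "i + 2 \<in> {2..<n}" by auto
      with \<omega> have "V (i + 2) \<omega> = fst (h ! i)" "W (i + 2) \<omega> = snd (h ! i)" by fastforce+
      then show "history n \<omega> ! i = h ! i" using i by (simp add: history_def add.commute)
    qed (use \<omega> in \<open>simp add: history_def\<close>)
    with \<omega> show "\<omega> \<in> ?L" by simp
  qed
  also have "\<dots> \<in> sets M" by measurable
  finally show "history n -` {h} \<inter> space M \<in> sets M" .
qed simp_all

text \<open>
  Measurability with respect to the history, expressed by a factorisation: histories form a countable
  discrete space, on which every function is measurable.
\<close>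

definition adapted :: "nat \<Rightarrow> ('a \<Rightarrow> real) \<Rightarrow> bool" where
  "adapted n F \<longleftrightarrow> (\<exists>f. \<forall>\<omega>\<in>space M. F \<omega> = f (history n \<omega>))"

lemma adaptedI:
  assumes "\<And>\<omega> \<omega>'. \<omega> \<in> space M \<Longrightarrow> \<omega>' \<in> space M \<Longrightarrow> history n \<omega> = history n \<omega>' \<Longrightarrow> F \<omega> = F \<omega>'"
  shows "adapted n F"
proof -
  \<comment> \<open>\<open>f h\<close> is the value of \<open>F\<close> at any outcome with history \<open>h\<close>.\<close>
  let ?f = "\<lambda>h. F (SOME \<omega>. \<omega> \<in> space M \<and> history n \<omega> = h)"
  have "F \<omega> = ?f (history n \<omega>)" if "\<omega> \<in> space M" for \<omega>
  proof -
    have "\<exists>\<omega>'. \<omega>' \<in> space M \<and> history n \<omega>' = history n \<omega>" using that by blast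
    from someI_ex[OF this] show ?thesis by (intro assms that) auto
  qed
  then show ?thesis unfolding adapted_def by (intro exI[of _ ?f] ballI)
qed

lemma borel_measurable_adapted:
  assumes "adapted n F" shows "F \<in> borel_measurable M"
proof -
  obtain f where f: "\<And>\<omega>. \<omega> \<in> space M \<Longrightarrow> F \<omega> = f (history n \<omega>)"
    using assms unfolding adapted_def by blast
  have "(\<lambda>\<omega>. f (history n \<omega>)) \<in> borel_measurable M" by measurable
  then show ?thesis using f by (subst measurable_cong[of M F]) auto
qed

section \<open>The law of the choices given the history\<close>

text \<open>
  Multiplying the conditional law of \<open>V n\<close> by the probability of the condition gives an identity that
  is also true for histories of probability zero, where conditional probabilities say nothing.
\<close>

lemma prob_V_given_history:
  assumes "n \<ge> 2" "x \<in> {1..n}"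
  shows "\<P>(\<omega> in M. history n \<omega> = h \<and> V n \<omega> = x) = \<P>(\<omega> in M. history n \<omega> = h) / n"
proof (cases "\<P>(\<omega> in M. history n \<omega> = h) > 0")
  case True
  then have "{\<omega> \<in> space M. history n \<omega> = h} \<noteq> {}" by (metis measure_empty less_irrefl)
  then obtain \<omega>' where \<omega>': "\<omega>' \<in> space M" "history n \<omega>' = h" by blast
  let ?P = "past T V W n (\<lambda>k. T k \<omega>') (\<lambda>k. V k \<omega>') (\<lambda>k. W k \<omega>')"
  have P: "{\<omega> \<in> space M. ?P \<omega>} = {\<omega> \<in> space M. history n \<omega> = h}"
    "{\<omega> \<in> space M. V n \<omega> = x \<and> ?P \<omega>} = {\<omega> \<in> space M. history n \<omega> = h \<and> V n \<omega> = x}"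
    using past_iff_history_eq[OF _ \<omega>'(1)] \<omega>'(2) by auto
  have "\<P>(\<omega> in M. V n \<omega> = x \<bar> ?P \<omega>) = 1 / real n"
    using True assms by (intro V_uniform) (simp_all only: P)
  then show ?thesis using True unfolding cond_prob_def P by (simp add: field_simps)
next
  case False
  have [measurable]: "V n \<in> measurable M (count_space UNIV)" using assms by (intro V_measurable)
  have "\<P>(\<omega> in M. history n \<omega> = h \<and> V n \<omega> = x) \<le> \<P>(\<omega> in M. history n \<omega> = h)"
    by (intro finite_measure_mono) auto
  with False have "\<P>(\<omega> in M. history n \<omega> = h) = 0" "\<P>(\<omega> in M. history n \<omega> = h \<and> V n \<omega> = x) = 0"
    by (simp_all add: not_less measure_le_0_iff)
  then show ?thesis by simp
qed

text \<open>
  The value of \<open>T n\<close> on the event that the history equals that of \<open>\<omega>'\<close> is \<open>T n \<omega>'\<close>; naming the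
  history by an outcome gives access to this tree.
\<close>

lemma prob_VW_given_history:
  assumes n: "n \<ge> 2" and x: "x \<in> {1..n}" and \<omega>': "\<omega>' \<in> space M" and y: "y \<in> neighbours (T n \<omega>') x"
  shows "\<P>(\<omega> in M. history n \<omega> = history n \<omega>' \<and> V n \<omega> = x \<and> W n \<omega> = y) =
    \<P>(\<omega> in M. history n \<omega> = history n \<omega>') / n / vertex_degree (T n \<omega>') x"
proof (cases "\<P>(\<omega> in M. history n \<omega> = history n \<omega>' \<and> V n \<omega> = x) > 0")
  case True
  let ?P = "past T V W n (\<lambda>k. T k \<omega>') (\<lambda>k. V k \<omega>') (\<lambda>k. W k \<omega>')"
  have P: "{\<omega> \<in> space M. ?P \<omega> \<and> V n \<omega> = x} = {\<omega> \<in> space M. history n \<omega> = history n \<omega>' \<and> V n \<omega> = x}"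
    "{\<omega> \<in> space M. W n \<omega> = y \<and> ?P \<omega> \<and> V n \<omega> = x} =
     {\<omega> \<in> space M. history n \<omega> = history n \<omega>' \<and> V n \<omega> = x \<and> W n \<omega> = y}"
    using past_iff_history_eq[OF _ \<omega>'] by auto
  have "\<P>(\<omega> in M. W n \<omega> = y \<bar> ?P \<omega> \<and> V n \<omega> = x) = 1 / real (vertex_degree (T n \<omega>') x)"
    using True n y by (intro W_uniform) (simp_all only: P)
  then show ?thesis
    using True unfolding cond_prob_def P prob_V_given_history[OF n x, symmetric]
    by (auto simp: field_simps)
next
  case False
  have [measurable]: "V n \<in> measurable M (count_space UNIV)" "W n \<in> measurable M (count_space UNIV)"
    using n by (auto intro: V_measurable W_measurable)
  have "\<P>(\<omega> in M. history n \<omega> = history n \<omega>' \<and> V n \<omega> = x \<and> W n \<omega> = y) \<le>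
      \<P>(\<omega> in M. history n \<omega> = history n \<omega>' \<and> V n \<omega> = x)"
    by (intro finite_measure_mono) auto
  with False have "\<P>(\<omega> in M. history n \<omega> = history n \<omega>' \<and> V n \<omega> = x \<and> W n \<omega> = y) = 0"
    "\<P>(\<omega> in M. history n \<omega> = history n \<omega>' \<and> V n \<omega> = x) = 0"
    by (simp_all add: not_less measure_le_0_iff)
  then show ?thesis by (simp flip: prob_V_given_history[OF n x])
qed

text \<open>
  Each vertex is joined to something when it is added, even by an inadmissible choice of \<open>W\<close>.
\<close>

lemma vertex_degree_pos:
  assumes "\<omega> \<in> space M" "n \<ge> 2" "x \<in> {1..n}"
  shows "vertex_degree (T n \<omega>) x > 0"
proof -
  have "neighbours (T n \<omega>) x \<noteq> {}"
    using assms(2,3)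
  proof (induction n rule: dec_induct)
    case base
    then have "x = 1 \<or> x = 2" by auto
    then show ?case by (auto simp: T_2[OF assms(1)] neighbours_def doubleton_eq_iff)
  next
    case (step n)
    then show ?case by (cases "x = Suc n") (auto simp: T_Suc[OF assms(1)] neighbours_insert)
  qed
  then show ?thesis
    using degree_le[OF assms(1,2)] by (simp add: vertex_degree_def card_gt_0_iff)
qed

text \<open>
  The locale prescribes the probabilities of the values in \<open>{1..n}\<close> only. They add up to 1, which
  leaves no mass for other values; the same argument applies to \<open>W n\<close> below.
\<close>

lemma AE_V_in:
  assumes "n \<ge> 2"
  shows "AE \<omega> in M. V n \<omega> \<in> {1..n}"
proof -
  have [measurable]: "V n \<in> measurable M (count_space UNIV)" using assms by (intro V_measurable)
  have "AE \<omega> in M. history n \<omega> = h \<longrightarrow> V n \<omega> \<in> {1..n}" for h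
  proof (rule AE_in_if_prob_sum_eq)
    have "(\<Sum>x\<in>{1..n}. \<P>(\<omega> in M. history n \<omega> = h \<and> V n \<omega> = x)) =
        (\<Sum>x\<in>{1..n}. \<P>(\<omega> in M. history n \<omega> = h) / n)"
      using assms by (intro sum.cong refl prob_V_given_history)
    then show "(\<Sum>x\<in>{1..n}. \<P>(\<omega> in M. history n \<omega> = h \<and> V n \<omega> = x)) =
        \<P>(\<omega> in M. history n \<omega> = h)" using assms by simp
  qed auto
  then have "AE \<omega> in M. \<forall>h. history n \<omega> = h \<longrightarrow> V n \<omega> \<in> {1..n}"
    unfolding AE_all_countable by blast
  then show ?thesis by simp
qed

lemma AE_W_in:
  assumes n: "n \<ge> 2"
  shows "AE \<omega> in M. W n \<omega> \<in> neighbours (T n \<omega>) (V n \<omega>)"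
proof -
  have [measurable]: "V n \<in> measurable M (count_space UNIV)" "W n \<in> measurable M (count_space UNIV)"
    using n by (auto intro: V_measurable W_measurable)
  have "AE \<omega> in M. \<omega> \<in> space M \<longrightarrow> history n \<omega> = h \<and> V n \<omega> = x \<longrightarrow> W n \<omega> \<in> neighbours (T n \<omega>) x"
    if x: "x \<in> {1..n}" for h x
  proof (cases "\<exists>\<omega>'\<in>space M. history n \<omega>' = h")
    case True
    then obtain \<omega>' where \<omega>': "\<omega>' \<in> space M" "h = history n \<omega>'" by blast
    let ?N = "neighbours (T n \<omega>') x"
    have deg: "finite ?N" "card ?N \<noteq> 0"
      using degree_le[OF \<omega>'(1) n] vertex_degree_pos[OF \<omega>'(1) n x] by (auto simp: vertex_degree_def)
    have "(\<Sum>y\<in>?N. \<P>(\<omega> in M. (history n \<omega> = h \<and> V n \<omega> = x) \<and> W n \<omega> = y)) =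
        (\<Sum>y\<in>?N. \<P>(\<omega> in M. history n \<omega> = h) / n / vertex_degree (T n \<omega>') x)"
      by (intro sum.cong refl) (simp add: \<omega>' prob_VW_given_history[OF n x])
    also have "\<dots> = \<P>(\<omega> in M. history n \<omega> = h) / n"
      using deg by (simp add: vertex_degree_def del: card_eq_0_iff)
    also have "\<dots> = \<P>(\<omega> in M. history n \<omega> = h \<and> V n \<omega> = x)"
      by (rule prob_V_given_history[OF n x, symmetric])
    finally have "AE \<omega> in M. history n \<omega> = h \<and> V n \<omega> = x \<longrightarrow> W n \<omega> \<in> ?N"
      by (intro AE_in_if_prob_sum_eq deg) measurable
    then show ?thesis
    proof eventually_elim
      case (elim \<omega>)
      show ?case
      proof (intro impI, elim conjE)
        assume "\<omega> \<in> space M" "history n \<omega> = h" "V n \<omega> = x"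
        with elim T_eq_if_history_eq[of \<omega> \<omega>' n n] \<omega>' n
        show "W n \<omega> \<in> neighbours (T n \<omega>) x" by simp
      qed
    qed
  next
    case False
    then show ?thesis by (intro AE_I2) blast
  qed
  then have "AE \<omega> in M. \<forall>h. \<forall>x\<in>{1..n}. \<omega> \<in> space M \<longrightarrow> history n \<omega> = h \<and> V n \<omega> = x \<longrightarrow>
      W n \<omega> \<in> neighbours (T n \<omega>) x"
    unfolding AE_all_countable by (intro allI AE_finite_allI) auto
  with AE_V_in[OF n] AE_space show ?thesis by eventually_elim blast
qed

text \<open>
  The conditional probability of \<open>W n = u\<close> given the history, see \<open>prob_W_given_history\<close>. On the null
  event where earlier choices were inadmissible, \<open>u\<close> may have a neighbour outside \<open>{1..n}\<close>; the
  intersection discards it, so that the formula is correct for every outcome.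
\<close>

definition friend_prob :: "nat \<Rightarrow> nat \<Rightarrow> 'a \<Rightarrow> real" where
  "friend_prob n u \<omega> =
     (\<Sum>x\<in>neighbours (T n \<omega>) u \<inter> {1..n}. 1 / real (vertex_degree (T n \<omega>) x)) / real n"

lemma friend_prob_nonneg: "friend_prob n u \<omega> \<ge> 0"
  unfolding friend_prob_def by (intro divide_nonneg_nonneg sum_nonneg) auto

text \<open>
  Every neighbour \<open>x\<close> of \<open>u\<close> contributes at most 1. This inequality makes the degree ratio a
  supermartingale.
\<close>

lemma friend_prob_le:
  assumes "\<omega> \<in> space M" "n \<ge> 2"
  shows "friend_prob n u \<omega> \<le> real (vertex_degree (T n \<omega>) u) / real n"
proof -
  have "(\<Sum>x\<in>neighbours (T n \<omega>) u \<inter> {1..n}. 1 / real (vertex_degree (T n \<omega>) x)) \<le>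
      (\<Sum>x\<in>neighbours (T n \<omega>) u \<inter> {1..n}. 1)"
    by (intro sum_mono) (auto simp: divide_le_eq_1 Suc_le_eq)
  also have "\<dots> \<le> real (vertex_degree (T n \<omega>) u)"
    using degree_le[OF assms] by (auto simp: vertex_degree_def intro: card_mono)
  finally show ?thesis unfolding friend_prob_def by (intro divide_right_mono) auto
qed

lemma friend_prob_le_1:
  assumes "\<omega> \<in> space M" "n \<ge> 2"
  shows "friend_prob n u \<omega> \<le> 1"
proof -
  have "real (vertex_degree (T n \<omega>) u) / real n \<le> 1"
    using degree_le[OF assms, of u] assms(2) by (simp add: divide_le_eq_1)
  with friend_prob_le[OF assms] show ?thesis by (rule order_trans)
qed

lemma adapted_friend_prob:
  assumes "2 \<le> m" "m \<le> n"
  shows "adapted n (friend_prob m u)"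
proof (rule adaptedI)
  fix \<omega> \<omega>' assume "\<omega> \<in> space M" "\<omega>' \<in> space M" "history n \<omega> = history n \<omega>'"
  then have "T m \<omega> = T m \<omega>'" using assms by (intro T_eq_if_history_eq[where n = n]) auto
  then show "friend_prob m u \<omega> = friend_prob m u \<omega>'" by (simp add: friend_prob_def)
qed

lemma prob_W_given_history:
  assumes n: "n \<ge> 2" and \<omega>': "\<omega>' \<in> space M"
  shows "\<P>(\<omega> in M. history n \<omega> = history n \<omega>' \<and> W n \<omega> = u) =
    \<P>(\<omega> in M. history n \<omega> = history n \<omega>') * friend_prob n u \<omega>'"
proof -
  have Vm[measurable]: "V n \<in> measurable M (count_space UNIV)"
    and [measurable]: "W n \<in> measurable M (count_space UNIV)"
    using n by (auto intro: V_measurable W_measurable)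
  let ?h = "\<lambda>\<omega>. history n \<omega> = history n \<omega>'" and ?N = "neighbours (T n \<omega>') u"
  have Vn[measurable]: "Measurable.pred M (\<lambda>\<omega>. V n \<omega> \<in> {1..n})"
    by (rule pred_sets2[OF _ Vm]) simp
  have "\<P>(\<omega> in M. ?h \<omega> \<and> W n \<omega> = u) = \<P>(\<omega> in M. (?h \<omega> \<and> W n \<omega> = u) \<and> V n \<omega> \<in> {1..n})"
  proof (rule finite_measure_eq_AE)
    show "AE \<omega> in M. (\<omega> \<in> {\<omega> \<in> space M. ?h \<omega> \<and> W n \<omega> = u}) =
        (\<omega> \<in> {\<omega> \<in> space M. (?h \<omega> \<and> W n \<omega> = u) \<and> V n \<omega> \<in> {1..n}})"
      using AE_V_in[OF n] by eventually_elim blast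
  qed measurable
  also have "\<dots> = (\<Sum>x\<in>{1..n}. \<P>(\<omega> in M. (?h \<omega> \<and> W n \<omega> = u) \<and> V n \<omega> = x))"
    by (intro prob_eq_sum_values) auto
  also have "\<dots> = (\<Sum>x\<in>{1..n}. if x \<in> ?N
      then \<P>(\<omega> in M. ?h \<omega>) / n * (1 / vertex_degree (T n \<omega>') x) else 0)"
  proof (intro sum.cong refl)
    fix x assume x: "x \<in> {1..n}"
    have eq: "{\<omega> \<in> space M. (?h \<omega> \<and> W n \<omega> = u) \<and> V n \<omega> = x} =
        {\<omega> \<in> space M. ?h \<omega> \<and> V n \<omega> = x \<and> W n \<omega> = u}" by auto
    show "\<P>(\<omega> in M. (?h \<omega> \<and> W n \<omega> = u) \<and> V n \<omega> = x) = (if x \<in> ?N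
      then \<P>(\<omega> in M. ?h \<omega>) / n * (1 / vertex_degree (T n \<omega>') x) else 0)"
    proof (cases "x \<in> ?N")
      case True
      then have "u \<in> neighbours (T n \<omega>') x" using neighbours_sym by blast
      from prob_VW_given_history[OF n x \<omega>' this] True show ?thesis unfolding eq by simp
    next
      \<comment> \<open>\<open>W n\<close> is almost surely a neighbour of \<open>V n\<close>, so it cannot be \<open>u\<close> when \<open>V n\<close> is not adjacent to \<open>u\<close>.\<close>
      case False
      have "AE \<omega> in M. \<omega> \<notin> {\<omega> \<in> space M. ?h \<omega> \<and> V n \<omega> = x \<and> W n \<omega> = u}"
        using AE_W_in[OF n]
      proof eventually_elim
        case (elim \<omega>)
        show ?case
        proof
          assume *: "\<omega> \<in> {\<omega> \<in> space M. ?h \<omega> \<and> V n \<omega> = x \<and> W n \<omega> = u}"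
          then have "T n \<omega> = T n \<omega>'" using n \<omega>' by (intro T_eq_if_history_eq[where n = n]) auto
          with elim * have "u \<in> neighbours (T n \<omega>') x" by simp
          with False show False using neighbours_sym by blast
        qed
      qed
      moreover have "{\<omega> \<in> space M. ?h \<omega> \<and> V n \<omega> = x \<and> W n \<omega> = u} \<in> events" by measurable
      ultimately show ?thesis using False unfolding eq by (simp add: prob_eq_0)
    qed
  qed
  also have "\<dots> = (\<Sum>x\<in>?N \<inter> {1..n}. \<P>(\<omega> in M. ?h \<omega>) / n * (1 / vertex_degree (T n \<omega>') x))"
    by (simp add: sum.inter_restrict[symmetric] Int_commute)
  also have "\<dots> = \<P>(\<omega> in M. ?h \<omega>) * friend_prob n u \<omega>'"
    unfolding sum_distrib_left[symmetric] friend_prob_def by simp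
  finally show ?thesis .
qed

lemma prob_V_eq:
  assumes n: "n \<ge> 2" and u: "u \<in> {1..n}"
  shows "\<P>(\<omega> in M. V n \<omega> = u) = 1 / n"
proof -
  have [measurable]: "V n \<in> measurable M (count_space UNIV)" using n by (intro V_measurable)
  have int: "integrable M (\<lambda>\<omega>. of_bool (V n \<omega> = u) :: real)" by (intro integrable_of_bool) measurable
  have "expectation (\<lambda>\<omega>. of_bool (V n \<omega> = u) - 1 / n) = 0"
  proof (rule expectation_eq_0_if_fibrewise[where X = "history n"])
    fix h
    have "expectation (\<lambda>\<omega>. of_bool (history n \<omega> = h) * (of_bool (V n \<omega> = u) - 1 / n)) =
        expectation (\<lambda>\<omega>. of_bool (history n \<omega> = h \<and> V n \<omega> = u) - of_bool (history n \<omega> = h) / n)"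
      by (intro Bochner_Integration.integral_cong) auto
    also have "\<dots> = \<P>(\<omega> in M. history n \<omega> = h \<and> V n \<omega> = u) - \<P>(\<omega> in M. history n \<omega> = h) / n"
      by (subst Bochner_Integration.integral_diff)
        (auto intro!: integrable_of_bool integrable_divide_zero simp: expectation_of_bool)
    finally show "expectation (\<lambda>\<omega>. of_bool (history n \<omega> = h) * (of_bool (V n \<omega> = u) - 1 / n)) = 0"
      by (simp add: prob_V_given_history[OF n u])
  qed (use int in auto)
  then show ?thesis
    using int by (simp add: prob_space expectation_of_bool)
qed

section \<open>The martingale part of the degree ratio\<close>

definition innovation :: "nat \<Rightarrow> nat \<Rightarrow> 'a \<Rightarrow> real" where
  "innovation u n \<omega> = of_bool (W n \<omega> = u) - friend_prob n u \<omega>"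

lemma measurable_innovation:
  assumes "n \<ge> 2" shows "innovation u n \<in> borel_measurable M"
proof -
  have [measurable]: "W n \<in> measurable M (count_space UNIV)" "friend_prob n u \<in> borel_measurable M"
    using assms by (auto intro: W_measurable borel_measurable_adapted adapted_friend_prob)
  show ?thesis unfolding innovation_def by measurable
qed

lemma abs_innovation_le_1:
  assumes "\<omega> \<in> space M" "n \<ge> 2"
  shows "\<bar>innovation u n \<omega>\<bar> \<le> 1"
  using friend_prob_nonneg[of n u \<omega>] friend_prob_le_1[OF assms, of u]
  by (auto simp: innovation_def)

lemma adapted_innovation:
  assumes "2 \<le> m" "m < n"
  shows "adapted n (innovation u m)"
proof (rule adaptedI)
  fix \<omega> \<omega>' assume *: "\<omega> \<in> space M" "\<omega>' \<in> space M" "history n \<omega> = history n \<omega>'"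
  then have "T m \<omega> = T m \<omega>'" using assms by (intro T_eq_if_history_eq[where n = n]) auto
  moreover have "W m \<omega> = W m \<omega>'" using *(3) assms by (simp add: history_eq_iff)
  ultimately show "innovation u m \<omega> = innovation u m \<omega>'" by (simp add: innovation_def friend_prob_def)
qed

text \<open>
  On a single history \<open>F\<close> and the choice probability are constant, and the expectation reduces to
  \<open>prob_W_given_history\<close>. Taking for \<open>F\<close> an earlier innovation gives orthogonality.
\<close>

lemma innovation_centred:
  assumes n: "n \<ge> 2" and F: "adapted n F" and int: "integrable M (\<lambda>\<omega>. F \<omega> * innovation u n \<omega>)"
  shows "expectation (\<lambda>\<omega>. F \<omega> * innovation u n \<omega>) = 0"
proof (rule expectation_eq_0_if_fibrewise[OF measurable_history int])
  fix h
  have [measurable]: "W n \<in> measurable M (count_space UNIV)" using n by (intro W_measurable)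
  show "expectation (\<lambda>\<omega>. of_bool (history n \<omega> = h) * (F \<omega> * innovation u n \<omega>)) = 0"
  proof (cases "\<exists>\<omega>'\<in>space M. history n \<omega>' = h")
    case True
    then obtain \<omega>' where \<omega>': "\<omega>' \<in> space M" "h = history n \<omega>'" by blast
    let ?p = "friend_prob n u \<omega>'"
    have const: "F \<omega> = F \<omega>'" "friend_prob n u \<omega> = ?p"
      if "\<omega> \<in> space M" "history n \<omega> = h" for \<omega>
      using F adapted_friend_prob[OF n order_refl, of u] that \<omega>' unfolding adapted_def by metis+
    have "expectation (\<lambda>\<omega>. of_bool (history n \<omega> = h) * (F \<omega> * innovation u n \<omega>)) =
      expectation (\<lambda>\<omega>. F \<omega>' * (of_bool (history n \<omega> = h \<and> W n \<omega> = u) -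
        of_bool (history n \<omega> = h) * ?p))"
      by (intro Bochner_Integration.integral_cong refl) (auto simp: innovation_def const)
    also have "\<dots> = F \<omega>' * (\<P>(\<omega> in M. history n \<omega> = h \<and> W n \<omega> = u) -
        \<P>(\<omega> in M. history n \<omega> = h) * ?p)"
      by (subst integral_mult_right_zero, subst Bochner_Integration.integral_diff)
        (auto intro!: integrable_of_bool simp: expectation_of_bool)
    also have "\<dots> = 0" unfolding \<omega>'(2) prob_W_given_history[OF n \<omega>'(1)] by simp
    finally show ?thesis .
  next
    case False
    then have "expectation (\<lambda>\<omega>. of_bool (history n \<omega> = h) * (F \<omega> * innovation u n \<omega>)) =
      expectation (\<lambda>\<omega>. 0)"
      by (intro Bochner_Integration.integral_cong refl) auto
    then show ?thesis by simp
  qed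
qed

text \<open>
  The values of \<open>W\<close> before time 2 are arbitrary, so these terms are set to zero.
\<close>

lemma AE_convergent_innovation_series:
  "AE \<omega> in M. convergent (\<lambda>n. \<Sum>j<n. (if j < 2 then 0 else innovation u j \<omega>) / real (Suc j))"
proof (rule AE_convergent_orthogonal_series)
  fix i j :: nat assume "i < j"
  show "expectation (\<lambda>\<omega>. (if i < 2 then 0 else innovation u i \<omega>) *
      (if j < 2 then 0 else innovation u j \<omega>)) = 0"
  proof (cases "i < 2")
    case False
    with \<open>i < j\<close> have ij: "2 \<le> i" "2 \<le> j" by auto
    note [measurable] = ij[THEN measurable_innovation]
    have "integrable M (\<lambda>\<omega>. innovation u i \<omega> * innovation u j \<omega>)"
      by (rule integrable_const_bound[where B = 1])
        (use ij in \<open>auto simp: abs_mult intro!: mult_le_one abs_innovation_le_1\<close>)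
    from innovation_centred[OF ij(2) adapted_innovation[OF ij(1) \<open>i < j\<close>] this]
    show ?thesis using ij by simp
  qed simp
next
  fix j show "(\<lambda>\<omega>. if j < 2 then 0 else innovation u j \<omega>) \<in> borel_measurable M"
    by (cases "j < 2") (simp_all add: measurable_innovation)
qed (simp add: abs_innovation_le_1)

text \<open>
  The expectations are \<open>1 / k\<^sup>2\<close> once \<open>u\<close> is a vertex of the tree, that is for \<open>k \<ge> u\<close>.
\<close>

lemma AE_summable_V:
  assumes u: "u \<ge> 1"
  shows "AE \<omega> in M. summable (\<lambda>k. of_bool (k \<ge> max 2 u \<and> V k \<omega> = u) / real k)"
proof (rule AE_summable_if_summable_expectation[where b = "\<lambda>k. 1 / real k ^ 2"])
  fix k
  show "integrable M (\<lambda>\<omega>. of_bool (k \<ge> max 2 u \<and> V k \<omega> = u) / real k)"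
    and "expectation (\<lambda>\<omega>. of_bool (k \<ge> max 2 u \<and> V k \<omega> = u) / real k) \<le> 1 / real k ^ 2"
  proof (atomize(full), cases "k \<ge> max 2 u")
    case True
    then have [measurable]: "V k \<in> measurable M (count_space UNIV)" by (auto intro: V_measurable)
    have *: "integrable M (\<lambda>\<omega>. of_bool (V k \<omega> = u) :: real)" by (intro integrable_of_bool) measurable
    have "expectation (\<lambda>\<omega>. of_bool (V k \<omega> = u)) = 1 / k"
      using True u by (subst expectation_of_bool) (auto simp: prob_V_eq)
    then show "integrable M (\<lambda>\<omega>. of_bool (k \<ge> max 2 u \<and> V k \<omega> = u) / real k) \<and>
      expectation (\<lambda>\<omega>. of_bool (k \<ge> max 2 u \<and> V k \<omega> = u) / real k) \<le> 1 / real k ^ 2"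
      using True * by (simp add: power2_eq_square)
  qed auto
next
  show "summable (\<lambda>k. 1 / real k ^ 2)"
    using inverse_power_summable[of 2, where 'a = real] by (simp add: inverse_eq_divide)
qed auto

section \<open>Growth of the tree along a typical outcome\<close>

definition valid_choices :: "'a \<Rightarrow> bool" where
  "valid_choices \<omega> \<longleftrightarrow> (\<forall>n\<ge>2. V n \<omega> \<in> {1..n} \<and> W n \<omega> \<in> neighbours (T n \<omega>) (V n \<omega>))"

lemma AE_valid_choices: "AE \<omega> in M. valid_choices \<omega>"
proof -
  have "AE \<omega> in M. n \<ge> 2 \<longrightarrow> V n \<omega> \<in> {1..n} \<and> W n \<omega> \<in> neighbours (T n \<omega>) (V n \<omega>)" for n
    using AE_V_in[of n] AE_W_in[of n] by (cases "n \<ge> 2") auto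
  then show ?thesis unfolding valid_choices_def AE_all_countable by blast
qed

lemma neighbours_T_Suc:
  assumes "\<omega> \<in> space M" "n \<ge> 2"
  shows "neighbours (T (Suc n) \<omega>) v = neighbours (T n \<omega>) v \<union>
    (if v = W n \<omega> then {Suc n} else {}) \<union> (if v = Suc n then {W n \<omega>} else {})"
  unfolding T_Suc[OF assms] neighbours_insert ..

lemma edge_within:
  assumes \<omega>: "\<omega> \<in> space M" and valid: "valid_choices \<omega>" and n: "n \<ge> 2"
    and w: "w \<in> neighbours (T n \<omega>) v"
  shows "v \<in> {1..n} \<and> w \<in> {1..n} \<and> v \<noteq> w"
  using n w
proof (induction n arbitrary: v w rule: dec_induct)
  case base
  then show ?case by (auto simp: T_2[OF \<omega>] neighbours_def doubleton_eq_iff)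
next
  case (step n)
  have "W n \<omega> \<in> {1..n}" using step.IH valid step.hyps(1) by (auto simp: valid_choices_def)
  with step.prems show ?case
    unfolding neighbours_T_Suc[OF \<omega> step.hyps(1)] by (auto split: if_splits dest: step.IH)
qed

lemma vertex_degree_Suc:
  assumes \<omega>: "\<omega> \<in> space M" and valid: "valid_choices \<omega>" and n: "n \<ge> 2" and v: "v \<noteq> Suc n"
  shows "vertex_degree (T (Suc n) \<omega>) v = vertex_degree (T n \<omega>) v + of_bool (W n \<omega> = v)"
proof -
  have "Suc n \<notin> neighbours (T n \<omega>) v" using edge_within[OF \<omega> valid n] by fastforce
  then show ?thesis
    using degree_le[OF \<omega> n, of v] v by (auto simp: vertex_degree_def neighbours_T_Suc[OF \<omega> n])
qed

text \<open>
  If \<open>W n = u\<close>, then \<open>u\<close> only gains a leaf. Otherwise the number of non-leaf neighbours changes only if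
  \<open>W n\<close> was a leaf adjacent to \<open>u\<close>; as \<open>V n\<close> is a neighbour of \<open>W n\<close>, it must then be \<open>u\<close>.
\<close>

lemma nonleaf_degree_Suc:
  assumes \<omega>: "\<omega> \<in> space M" and valid: "valid_choices \<omega>" and n: "n \<ge> 2" and u: "u \<le> n"
  shows "nonleaf_degree (T (Suc n) \<omega>) u \<le> nonleaf_degree (T n \<omega>) u + of_bool (V n \<omega> = u)"
proof -
  let ?N = "\<lambda>n. {w \<in> neighbours (T n \<omega>) u. vertex_degree (T n \<omega>) w \<noteq> 1}"
  have new: "vertex_degree (T (Suc n) \<omega>) (Suc n) = 1"
  proof -
    have "neighbours (T n \<omega>) (Suc n) = {}" using edge_within[OF \<omega> valid n] by fastforce
    moreover have "W n \<omega> \<noteq> Suc n"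
      using edge_within[OF \<omega> valid n] valid n by (fastforce simp: valid_choices_def)
    ultimately show ?thesis by (simp add: vertex_degree_def neighbours_T_Suc[OF \<omega> n])
  qed
  have "?N (Suc n) \<subseteq> ?N n \<union> (if V n \<omega> = u then {W n \<omega>} else {})"
  proof
    fix w assume w: "w \<in> ?N (Suc n)"
    with new have "w \<noteq> Suc n" by auto
    with w u have wu: "w \<in> neighbours (T n \<omega>) u"
      by (auto simp: neighbours_T_Suc[OF \<omega> n] split: if_splits)
    show "w \<in> ?N n \<union> (if V n \<omega> = u then {W n \<omega>} else {})"
    proof (cases "vertex_degree (T n \<omega>) w = 1")
      case True
      with w vertex_degree_Suc[OF \<omega> valid n \<open>w \<noteq> Suc n\<close>] have Ww: "W n \<omega> = w" by (cases "W n \<omega> = w") auto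
      from True obtain z where z: "neighbours (T n \<omega>) w = {z}"
        by (auto simp: vertex_degree_def card_1_singleton_iff)
      have "V n \<omega> \<in> neighbours (T n \<omega>) w" "u \<in> neighbours (T n \<omega>) w"
        using valid n Ww wu neighbours_sym by (auto simp: valid_choices_def)
      then show ?thesis using z Ww by auto
    qed (use wu in auto)
  qed
  moreover have "finite (?N n)" using degree_le[OF \<omega> n, of u] by simp
  ultimately have "card (?N (Suc n)) \<le> card (?N n \<union> (if V n \<omega> = u then {W n \<omega>} else {}))"
    by (intro card_mono) auto
  also have "\<dots> \<le> card (?N n) + card (if V n \<omega> = u then {W n \<omega>} else {})" by (rule card_Un_le)
  finally show ?thesis by (auto simp: nonleaf_degree_def split: if_splits)
qed

section \<open>Limits of the degree ratios\<close>

lemma convergent_degree_ratio: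
  assumes \<omega>: "\<omega> \<in> space M" and valid: "valid_choices \<omega>"
    and conv: "convergent (\<lambda>n. \<Sum>j<n. (if j < 2 then 0 else innovation u j \<omega>) / real (Suc j))"
  shows "convergent (\<lambda>n. real (vertex_degree (T n \<omega>) u) / real n)"
proof (rule convergent_if_increments_le_series[OF _ conv, of _ "max 2 u"])
  fix n assume "max 2 u \<le> n"
  then have n: "n \<ge> 2" "u \<noteq> Suc n" by auto
  let ?D = "real (vertex_degree (T n \<omega>) u)" and ?w = "of_bool (W n \<omega> = u) :: real"
  have "real (vertex_degree (T (Suc n) \<omega>) u) / real (Suc n) = (?D + ?w) / real (Suc n)"
    using vertex_degree_Suc[OF \<omega> valid n] by simp
  also have "\<dots> = ?D / real n + (?w - ?D / real n) / real (Suc n)"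
  proof -
    define r where "r = ?D / real n"
    have "?D = r * real n" using n(1) by (simp add: r_def)
    then show ?thesis unfolding r_def[symmetric] by (simp add: field_simps)
  qed
  \<comment> \<open>Replacing \<open>D / n\<close> by the smaller choice probability of \<open>u\<close> is the supermartingale inequality.\<close>
  also have "\<dots> \<le> ?D / real n + innovation u n \<omega> / real (Suc n)"
    using friend_prob_le[OF \<omega> n(1), of u]
    by (intro add_left_mono divide_right_mono) (auto simp: innovation_def)
  finally show "real (vertex_degree (T (Suc n) \<omega>) u) / real (Suc n) \<le>
      ?D / real n + (if n < 2 then 0 else innovation u n \<omega>) / real (Suc n)" using n(1) by simp
qed auto

lemma nonleaf_ratio_tendsto_0:
  assumes \<omega>: "\<omega> \<in> space M" and valid: "valid_choices \<omega>"
    and sum: "summable (\<lambda>k. of_bool (k \<ge> max 2 u \<and> V k \<omega> = u) / real k)"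
  shows "(\<lambda>n. real (nonleaf_degree (T n \<omega>) u) / real n) \<longlonglongrightarrow> 0"
proof (rule sublinear_if_increments_summable[OF _ _ sum, of _ "max 2 u"])
  fix n assume n: "max 2 u \<le> n"
  then have "real (nonleaf_degree (T (Suc n) \<omega>) u) \<le>
      real (nonleaf_degree (T n \<omega>) u + of_bool (V n \<omega> = u))"
    by (intro of_nat_mono nonleaf_degree_Suc[OF \<omega> valid]) auto
  then show "real (nonleaf_degree (T (Suc n) \<omega>) u) \<le>
      real (nonleaf_degree (T n \<omega>) u) + of_bool (n \<ge> max 2 u \<and> V n \<omega> = u)" using n by simp
qed auto

lemma degree_ratio_tendsto_Z:
  assumes \<omega>: "\<omega> \<in> space M" and "convergent (\<lambda>n. real (vertex_degree (T n \<omega>) u) / real n)"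
  shows "(\<lambda>n. real (vertex_degree (T n \<omega>) u) / real n) \<longlonglongrightarrow> Z T u \<omega>"
proof -
  obtain l where l: "(\<lambda>n. real (vertex_degree (T n \<omega>) u) / real n) \<longlonglongrightarrow> l"
    using assms(2) by (auto simp: convergent_def)
  then have "liminf (\<lambda>n. ereal (real (vertex_degree (T n \<omega>) u) / real n)) = ereal l"
    by (intro lim_imp_Liminf) auto
  with ereal_Z[OF \<omega>, of u] l show ?thesis by simp
qed

end

theorem theorem3p1:
  fixes M :: "'a measure"
    and T :: "nat \<Rightarrow> 'a \<Rightarrow> edge_set"
    and V W :: "nat \<Rightarrow> 'a \<Rightarrow> nat"
    and u :: nat
  assumes "random_friend_tree M T V W"
    and "u \<ge> 1"
  shows "AE \<omega> in M.
    (\<lambda>n. real (vertex_degree (T n \<omega>) u) / real n) \<longlonglongrightarrow> Z T u \<omega> \<and>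
    (\<lambda>n. real (leaf_degree (T n \<omega>) u) / real n) \<longlonglongrightarrow> Z T u \<omega>"
proof -
  interpret random_friend_tree M T V W by fact
  show ?thesis
    using AE_space AE_valid_choices AE_convergent_innovation_series[of u] AE_summable_V[OF assms(2)]
  proof eventually_elim
    case (elim \<omega>)
    let ?D = "\<lambda>n. real (vertex_degree (T n \<omega>) u) / real n"
      and ?N = "\<lambda>n. real (nonleaf_degree (T n \<omega>) u) / real n"
    have D: "?D \<longlonglongrightarrow> Z T u \<omega>"
      by (intro degree_ratio_tendsto_Z convergent_degree_ratio elim)
    have "(\<lambda>n. ?D n - ?N n) \<longlonglongrightarrow> Z T u \<omega> - 0"
      by (intro tendsto_diff D nonleaf_ratio_tendsto_0 elim)
    moreover have "eventually (\<lambda>n. ?D n - ?N n = real (leaf_degree (T n \<omega>) u) / real n) sequentially"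
      using eventually_ge_at_top[of 2]
    proof eventually_elim
      case (elim n)
      have "finite (neighbours (T n \<omega>) u)" using degree_le[OF \<open>\<omega> \<in> space M\<close> elim] by blast
      from vertex_degree_eq_leaf_plus_nonleaf[OF this] show ?case
        by (simp add: diff_divide_distrib[symmetric])
    qed
    ultimately have "(\<lambda>n. real (leaf_degree (T n \<omega>) u) / real n) \<longlonglongrightarrow> Z T u \<omega>"
      by (simp add: tendsto_cong)
    with D show ?case by blast
  qed
qed

end
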